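(* Let $P\subset\mathbb{H}^2$ be a convex pentagon with four right angles and one ideal vertex, and let $B$ be a horoball centered at the ideal vertex of $P$. Let $d$ be the length of the side of $P$ opposite its ideal vertex, let $w_0$ and $w_1$ be the endpoints of this side, and for $i=0,1$ let $\ell_i$ be the length of the other side of $P$ containing $w_i$. If $v_i$ is the other endpoint of this other side (the side of length $\ell_i$), and $a_i$ is the signed distance from $v_i$ to $B$, for $i=0,1$, then \[ \cosh \ell_i = \frac{e^{a_i}\cosh d + e^{a_{1-i}}}{e^{a_i}\sinh d}\quad\text{for } i=0,1. \] Moreover, if $\theta$ is the length of the horocyclic arc $S\cap P$, where $S=\partial B$, then \[ \frac{\theta}{\sinh d} = \frac{\sinh \ell_0}{e^{a_1}} = \frac{\sinh \ell_1}{e^{a_0}}. \]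
   Context: The vertices of $P$ in cyclic order are: the ideal vertex, $v_0$, $w_0$, $w_1$, $v_1$; the sides are geodesic. The signed distance from a point $v$ to a horoball $B$ is the hyperbolic distance from $v$ to the horosphere $\partial B$, taken with positive sign if $v$ lies outside $B$ and negative sign if $v$ lies in the interior of $B$.
   Formalization: The formulas for θ are stated when S∩P is an arc with one endpoint on each of the two sides ending at the ideal vertex; otherwise they fail, e.g. for a horoball with some v_i in its interior. The equality sinh ℓ_0/e^{a_1} = sinh ℓ_1/e^{a_0} is proved for every horoball. *)

theory Defs
  imports "HOL-Analysis.Analysis" "HOL-Complex_Analysis.Riemann_Mapping"
begin

text \<open>
  The hyperbolic plane is the Poincare disc: the points are those of the open unit disc of the
  complex plane, with metric \<open>4 |dz|\<^sup>2 / (1 - |z|\<^sup>2)\<^sup>2\<close> (curvature -1), and the ideal points are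
  those of the unit circle.
\<close>

definition hplane :: "complex set" where
  "hplane = ball 0 1"

definition hdist :: "complex \<Rightarrow> complex \<Rightarrow> real" where
  "hdist z w = arcosh (1 + 2 * (norm (z - w))\<^sup>2 / ((1 - (norm z)\<^sup>2) * (1 - (norm w)\<^sup>2)))"

definition hlength :: "(real \<Rightarrow> complex) \<Rightarrow> real" where
  "hlength g =
     integral {0..1} (\<lambda>t. 2 * norm (vector_derivative g (at t)) / (1 - (norm (g t))\<^sup>2))"

text \<open>
  The geodesic from a point \<open>p\<close> towards \<open>q\<close>, where \<open>q\<close> may be ideal. The isometry
  \<open>Moebius_function 0 p\<close> moves \<open>p\<close> to the centre of the disc, where geodesics are Euclidean
  radii, and \<open>Moebius_function 0 (- p)\<close> is its inverse. The parametrisation is not by arc length.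
\<close>

definition hgeodesic :: "complex \<Rightarrow> complex \<Rightarrow> real \<Rightarrow> complex" where
  "hgeodesic p q t = Moebius_function 0 (- p) (of_real t * Moebius_function 0 p q)"

text \<open>
  For a point \<open>q\<close> of the plane this is the closed segment from \<open>p\<close> to \<open>q\<close>; for an ideal point
  \<open>q\<close> the intersection removes \<open>q\<close>, which leaves the ray from \<open>p\<close> to \<open>q\<close>.
\<close>

definition hside :: "complex \<Rightarrow> complex \<Rightarrow> complex set" where
  "hside p q = hplane \<inter> hgeodesic p q ` {0..1}"

definition hconvex :: "complex set \<Rightarrow> bool" where
  "hconvex A \<longleftrightarrow> A \<subseteq> hplane \<and> (\<forall>x\<in>A. \<forall>y\<in>A. hside x y \<subseteq> A)"

text \<open>
  Angle at \<open>p\<close> between the geodesics from \<open>p\<close> towards \<open>q\<close> and \<open>r\<close>, meaningful only if \<open>q\<close> and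
  \<open>r\<close> differ from \<open>p\<close>. The disc model is conformal, so this is the Euclidean angle between the
  tangent vectors.
\<close>

definition hangle :: "complex \<Rightarrow> complex \<Rightarrow> complex \<Rightarrow> real" where
  "hangle q p r =
     (let u = vector_derivative (hgeodesic p q) (at 0);
          v = vector_derivative (hgeodesic p r) (at 0)
      in arccos ((u \<bullet> v) / (norm u * norm v)))"

text \<open>
  \<open>P\<close> is a convex pentagon with vertices, in cyclic order, \<open>\<xi>\<close> (ideal), \<open>v 0\<close>, \<open>w 0\<close>,
  \<open>w 1\<close>, \<open>v 1\<close>: a closed convex region whose boundary in the plane is the union of the five
  sides, where consecutive sides share just their common vertex and other sides are disjoint.
  The ideal vertex is not a point of the plane, so the two sides ending there are disjoint.
\<close>

definition convex_ideal_pentagon ::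
    "complex \<Rightarrow> (nat \<Rightarrow> complex) \<Rightarrow> (nat \<Rightarrow> complex) \<Rightarrow> complex set \<Rightarrow> bool" where
  "convex_ideal_pentagon \<xi> v w P \<longleftrightarrow>
     norm \<xi> = 1 \<and> {v 0, w 0, w 1, v 1} \<subseteq> hplane \<and> distinct [v 0, w 0, w 1, v 1] \<and>
     closedin (top_of_set hplane) P \<and> hconvex P \<and> interior P \<noteq> {} \<and>
     hplane \<inter> frontier P =
       hside (v 0) \<xi> \<union> hside (v 0) (w 0) \<union> hside (w 0) (w 1) \<union> hside (v 1) (w 1) \<union> hside (v 1) \<xi> \<and>
     hside (v 0) \<xi> \<inter> hside (v 0) (w 0) = {v 0} \<and>
     hside (v 0) (w 0) \<inter> hside (w 0) (w 1) = {w 0} \<and>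
     hside (w 0) (w 1) \<inter> hside (v 1) (w 1) = {w 1} \<and>
     hside (v 1) (w 1) \<inter> hside (v 1) \<xi> = {v 1} \<and>
     hside (v 0) \<xi> \<inter> hside (v 1) \<xi> = {} \<and>
     hside (v 0) \<xi> \<inter> hside (w 0) (w 1) = {} \<and>
     hside (v 0) \<xi> \<inter> hside (v 1) (w 1) = {} \<and>
     hside (v 0) (w 0) \<inter> hside (v 1) (w 1) = {} \<and>
     hside (v 0) (w 0) \<inter> hside (v 1) \<xi> = {} \<and>
     hside (w 0) (w 1) \<inter> hside (v 1) \<xi> = {}"

text \<open>
  The interior angles at the four vertices in the plane. Since the pentagon is convex, they are
  the angles between the adjacent sides.
\<close>

definition right_angled :: "complex \<Rightarrow> (nat \<Rightarrow> complex) \<Rightarrow> (nat \<Rightarrow> complex) \<Rightarrow> bool" where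
  "right_angled \<xi> v w \<longleftrightarrow>
     hangle \<xi> (v 0) (w 0) = pi / 2 \<and> hangle (v 0) (w 0) (w 1) = pi / 2 \<and>
     hangle (w 0) (w 1) (v 1) = pi / 2 \<and> hangle (w 1) (v 1) \<xi> = pi / 2"

text \<open>
  Horoballs centred at \<open>\<xi>\<close> are the Euclidean discs in the unit disc that are tangent to the unit
  circle at \<open>\<xi>\<close>, without the point of tangency.
\<close>

definition horoball :: "complex \<Rightarrow> complex set \<Rightarrow> bool" where
  "horoball \<xi> B \<longleftrightarrow>
     (\<exists>\<rho>. 0 < \<rho> \<and> \<rho> < 1 \<and> B = cball (of_real (1 - \<rho>) * \<xi>) \<rho> - {\<xi>})"

definition horosphere :: "complex set \<Rightarrow> complex set" where
  "horosphere B = hplane \<inter> frontier B"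

definition signed_hdist :: "complex \<Rightarrow> complex set \<Rightarrow> real" where
  "signed_hdist x B =
     (if x \<in> interior B then -1 else 1) * (INF s\<in>horosphere B. hdist x s)"

text \<open>
  \<open>\<theta>\<close> is the length of the arc \<open>A\<close>, which runs from a point of \<open>E\<close> to a point of \<open>F\<close>.
\<close>

definition arc_of_length_between ::
    "complex set \<Rightarrow> real \<Rightarrow> complex set \<Rightarrow> complex set \<Rightarrow> bool" where
  "arc_of_length_between A \<theta> E F \<longleftrightarrow>
     (\<exists>g. valid_path g \<and> arc g \<and> path_image g = A \<and>
          pathstart g \<in> E \<and> pathfinish g \<in> F \<and> \<theta> = hlength g)"

end

theory Submission
  imports Defs
begin

text \<open>
  Move the ideal vertex \<open>\<xi>\<close> to \<open>\<infinity>\<close> in the upper half-plane by a Cayley map. The sides ending at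
  \<open>\<xi>\<close> become vertical rays from \<open>v\<^sub>i = (x\<^sub>i, y\<^sub>i)\<close>, so the sides \<open>v\<^sub>i w\<^sub>i\<close> lie on the circles of
  radius \<open>y\<^sub>i\<close> around \<open>x\<^sub>i\<close>, and \<open>w\<^sub>0 w\<^sub>1\<close> is the common perpendicular of these circles.
  If one circle were inside the other, its vertical ray would cross the other side \<open>v\<^sub>i w\<^sub>i\<close>;
  hence the circles lie outside each other, and all lengths are explicit functions of
  \<open>w\<^sub>0\<close> and \<open>w\<^sub>1\<close>. The horosphere is a horizontal line at some height \<open>h\<close>, so that
  \<open>exp a\<^sub>i = h / y\<^sub>i\<close> and \<open>\<theta> = \<bar>x\<^sub>1 - x\<^sub>0\<bar> / h\<close>.
\<close>

section \<open>Right angles and sides in the disc, expressed by Moebius functions\<close>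

lemma arccos_eq_pi_half: "\<bar>x\<bar> \<le> 1 \<Longrightarrow> arccos x = pi / 2 \<Longrightarrow> x = 0"
  using cos_arccos_abs[of x] cos_pi_half by metis

lemma norm_lt_1_imp_moebius_denom: "norm p < 1 \<Longrightarrow> norm q \<le> 1 \<Longrightarrow> 1 - cnj p * q \<noteq> 0"
proof
  assume "norm p < 1" "norm q \<le> 1" "1 - cnj p * q = 0"
  then have "norm p * norm q = 1"
    by (metis complex_mod_cnj eq_iff_diff_eq_0 norm_mult norm_one)
  with \<open>norm p < 1\<close> \<open>norm q \<le> 1\<close> show False
    using mult_left_le[of "norm q" "norm p"] by simp
qed

lemma hgeodesic_deriv_0:
  assumes "norm p < 1"
  shows "vector_derivative (hgeodesic p q) (at 0)
    = of_real (1 - (norm p)\<^sup>2) * Moebius_function 0 p q"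
proof -
  let ?c = "Moebius_function 0 p q"
  have "((\<lambda>z. (z * ?c + p) / (1 + cnj p * (z * ?c)))
      has_field_derivative (?c - p * cnj p * ?c)) (at 0)"
    by (auto intro!: derivative_eq_intros simp: algebra_simps)
  \<comment> \<open>\<open>has_vector_derivative_real_field\<close> expects the base point in the
    form \<open>of_real 0\<close>.\<close>
  then have "((\<lambda>z. (z * ?c + p) / (1 + cnj p * (z * ?c)))
      has_field_derivative (?c - p * cnj p * ?c)) (at (of_real 0))"
    by simp
  from has_vector_derivative_real_field[OF this]
  have "(hgeodesic p q has_vector_derivative (?c - p * cnj p * ?c)) (at 0)"
    by (simp add: hgeodesic_def[abs_def] Moebius_function_simple[of "- p"])
  then show ?thesis
    by (simp add: vector_derivative_at complex_norm_square[symmetric] algebra_simps)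
qed

lemma hangle_commute: "hangle q p r = hangle r p q"
  by (simp add: hangle_def Let_def inner_commute mult.commute)

text \<open>By \<open>hgeodesic_deriv_0\<close>, initial velocities are positive multiples of the
  Moebius values. Degenerate angles are covered too: a zero velocity is orthogonal to
  everything.\<close>

lemma hangle_right_imp_orthogonal:
  assumes "norm p < 1" and "hangle q p r = pi / 2"
  shows "Moebius_function 0 p q \<bullet> Moebius_function 0 p r = 0"
proof -
  let ?u = "vector_derivative (hgeodesic p q) (at 0)"
  let ?v = "vector_derivative (hgeodesic p r) (at 0)"
  \<comment> \<open>Cauchy-Schwarz puts the quotient in the interval where \<open>arccos\<close> can
    be inverted.\<close>
  have "\<bar>(?u \<bullet> ?v) / (norm ?u * norm ?v)\<bar> \<le> 1"
    using Cauchy_Schwarz_ineq2[of ?u ?v]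
    by (auto simp: abs_mult divide_le_eq_1 intro: order.antisym)
  then have "(?u \<bullet> ?v) / (norm ?u * norm ?v) = 0"
    using assms(2) by (intro arccos_eq_pi_half) (auto simp: hangle_def Let_def)
  then have uv: "?u \<bullet> ?v = 0" by auto
  have "?u \<bullet> ?v = (1 - (norm p)\<^sup>2)\<^sup>2 * (Moebius_function 0 p q \<bullet> Moebius_function 0 p r)"
    by (simp add: hgeodesic_deriv_0[OF assms(1)] scaleR_conv_of_real[symmetric]
        power2_eq_square del: of_real_diff of_real_power)
  moreover have "(norm p)\<^sup>2 < 1"
    using assms(1) by (simp add: abs_square_less_1)
  ultimately show ?thesis using uv by auto
qed

text \<open>Since \<open>a / c\<close> is \<open>a * cnj c\<close> divided by the square of
  \<open>norm c\<close>, positive real factors drop out of the orthogonality condition and a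
  polynomial one remains.\<close>

lemma inner_right_angle_iff:
  fixes u a b c d :: complex
  assumes "u \<noteq> 0" "c \<noteq> 0" "d \<noteq> 0"
  shows "(u * (a / c)) \<bullet> (u * (b / d)) = 0 \<longleftrightarrow> Re ((a * cnj c) * cnj (b * cnj d)) = 0"
proof -
  have "(u * (a / c)) \<bullet> (u * (b / d)) = Re ((u * (a / c)) * cnj (u * (b / d)))"
    by (simp only: inner_complex_def times_complex.sel complex_cnj cnj.sel)
  also have "(u * (a / c)) * cnj (u * (b / d))
      = of_real ((norm u)\<^sup>2 / ((norm c)\<^sup>2 * (norm d)\<^sup>2)) * ((a * cnj c) * cnj (b * cnj d))"
    using assms unfolding of_real_divide of_real_mult complex_norm_square
    by (simp add: field_simps)
  finally have eq: "(u * (a / c)) \<bullet> (u * (b / d))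
      = Re (of_real ((norm u)\<^sup>2 / ((norm c)\<^sup>2 * (norm d)\<^sup>2)) * ((a * cnj c) * cnj (b * cnj d)))" .
  have Re_scale: "Re (of_real k * w) = k * Re w" for k w by simp
  have "(norm u)\<^sup>2 / ((norm c)\<^sup>2 * (norm d)\<^sup>2) \<noteq> 0" using assms by simp
  then show ?thesis unfolding eq Re_scale mult_eq_0_iff by simp
qed

lemma mem_hside:
  assumes "norm p < 1" "norm z < 1" "t \<in> {0..1}"
    and "Moebius_function 0 p z = of_real t * Moebius_function 0 p q"
  shows "z \<in> hside p q"
proof -
  have "hgeodesic p q t = z"
    using assms Moebius_function_compose[of "- p" p z] by (simp add: hgeodesic_def)
  with assms show ?thesis by (force simp: hside_def hplane_def)
qed

lemma hsideE:
  assumes "z \<in> hside p q" and p: "norm p < 1"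
  obtains t where "Moebius_function 0 p z = of_real t * Moebius_function 0 p q"
proof -
  from assms obtain t where t: "z = hgeodesic p q t"
    by (auto simp: hside_def)
  let ?c = "of_real t * Moebius_function 0 p q"
  have z': "z = (?c + p) / (1 + cnj p * ?c)"
    using t by (simp add: hgeodesic_def Moebius_function_simple[of "- p"])
  show ?thesis
  proof (cases "1 + cnj p * ?c = 0")
    \<comment> \<open>Here \<open>z\<close> is the junk value \<open>0\<close> of a division by zero, which still has the required form.\<close>
    case True
    then have "z = 0" by (simp add: z')
    moreover have "of_real ((norm p)\<^sup>2) * ?c = - p"
    proof -
      have "cnj p * ?c = - 1" using True by (simp add: add_eq_0_iff)
      then show ?thesis
        unfolding complex_norm_square by (simp add: mult.assoc)
    qed
    ultimately have "Moebius_function 0 p z = of_real ((norm p)\<^sup>2 * t) * Moebius_function 0 p q"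
      by (simp add: Moebius_function_simple mult.assoc)
    then show ?thesis by (rule that)
  next
    case False
    have "1 - cnj p * p \<noteq> 0" using norm_lt_1_imp_moebius_denom[OF p] p by simp
    moreover have "1 - cnj p * z = (1 - cnj p * p) / (1 + cnj p * ?c)"
      unfolding z' using False by (simp add: field_simps)
    moreover have "z - p = ?c * (1 - cnj p * p) / (1 + cnj p * ?c)"
      unfolding z' using False by (simp add: field_simps)
    ultimately have "Moebius_function 0 p z = ?c"
      using False by (simp add: Moebius_function_simple)
    then show ?thesis by (rule that)
  qed
qed

section \<open>Algebra of the common perpendicular of two circles\<close>

text \<open>
  Here \<open>(p\<^sub>i, q\<^sub>i)\<close> is the foot of the common perpendicular on the circle of
  radius \<open>y\<^sub>i\<close> around \<open>x\<^sub>i\<close>, with \<open>s\<^sub>i = p\<^sub>i - x\<^sub>i\<close> and \<open>m = p\<^sub>1 - p\<^sub>0\<close>; thus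
  \<open>m + s\<^sub>0 - s\<^sub>1 = x\<^sub>1 - x\<^sub>0\<close>.
\<close>

lemma nested_circles_common_perpendicular:
  fixes m s0 s1 y0 y1 q0 q1 :: real
  assumes "q0 > 0" "q1 > 0" "m \<noteq> 0"
    and circ: "y0\<^sup>2 = q0\<^sup>2 + s0\<^sup>2" "y1\<^sup>2 = q1\<^sup>2 + s1\<^sup>2"
    and perp: "s0 * (m\<^sup>2 + q1\<^sup>2 - q0\<^sup>2) = 2 * q0\<^sup>2 * m" "s1 * (m\<^sup>2 + q0\<^sup>2 - q1\<^sup>2) = - 2 * q1\<^sup>2 * m"
    and bad: "m\<^sup>2 + q1\<^sup>2 < q0\<^sup>2"
  shows "(m + s0 - s1) * s0 \<ge> 0" "(m + s0 - s1)\<^sup>2 \<le> s0\<^sup>2" "(m + s0 - s1)\<^sup>2 + y1\<^sup>2 \<le> y0\<^sup>2"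
proof -
  define A B M where "A = q0\<^sup>2" and "B = q1\<^sup>2" and "M = m\<^sup>2"
  define G H where "G = M + B - A" and "H = M + A - B"
  \<comment> \<open>\<open>K\<close> equals \<open>(M + A + B)\<^sup>2 - 4 * A * B\<close>, the
    square of \<open>2 * q0 * q1 * sinh d\<close> for feet at distance \<open>d\<close>.\<close>
  define K where "K = M\<^sup>2 + 2 * M * (A + B) + (A - B)\<^sup>2"
  have pos: "A > 0" "B > 0" "M > 0" using assms by (auto simp: A_def B_def M_def)
  have "M + B < A" using bad by (simp add: A_def B_def M_def)
  then have G: "G < 0" and H: "H > 0" using pos by (simp_all add: G_def H_def)
  have K: "K > 0" using pos by (simp add: K_def add_pos_nonneg)
  have s0: "s0 = 2 * A * m / G" and s1: "s1 = - 2 * B * m / H"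
    using perp G H by (simp_all add: A_def B_def M_def G_def H_def field_simps)
  have "m * (G * H) + 2 * A * m * H + 2 * B * m * G = m * K"
    by (simp add: G_def H_def K_def power2_eq_square algebra_simps)
  then have a: "m + s0 - s1 = m * K / (G * H)"
    using G H by (simp add: s0 s1 field_simps)
  have "(m + s0 - s1) * s0 = 2 * A * K * m\<^sup>2 / (G\<^sup>2 * H)"
    unfolding a unfolding s0 by (simp add: power2_eq_square mult_ac)
  then show "(m + s0 - s1) * s0 \<ge> 0" using pos K H by simp
  \<comment> \<open>After cancelling \<open>m / G\<close>, the second claim compares
    \<open>K / H\<close> with \<open>2 * A\<close>.\<close>
  have "2 * A * H - K = - G * (M + A + B)"
    by (simp add: G_def H_def K_def power2_eq_square algebra_simps)
  moreover have "- G * (M + A + B) > 0" by (intro mult_pos_pos) (use G pos in auto)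
  ultimately have "K \<le> 2 * A * H" by simp
  then have "\<bar>K / H\<bar> \<le> \<bar>2 * A\<bar>" using H K pos by (simp add: field_simps)
  then have "(K / H)\<^sup>2 \<le> (2 * A)\<^sup>2" by (simp only: abs_le_square_iff)
  then have "(K / H)\<^sup>2 * (m / G)\<^sup>2 \<le> (2 * A)\<^sup>2 * (m / G)\<^sup>2" by (rule mult_right_mono) simp
  then show "(m + s0 - s1)\<^sup>2 \<le> s0\<^sup>2"
    unfolding a unfolding s0 by (simp add: power2_eq_square mult_ac)
  \<comment> \<open>Multiplied by \<open>G\<^sup>2 * H\<^sup>2\<close>, the third claim has slack
    \<open>- G * K\<^sup>2\<close>, which is nonnegative because \<open>G < 0\<close>.\<close>
  have "A * (G\<^sup>2 + 4 * A * M) * H\<^sup>2 - B * (H\<^sup>2 + 4 * B * M) * G\<^sup>2 - M * K\<^sup>2 = - G * K\<^sup>2"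
    by (simp add: G_def H_def K_def power2_eq_square algebra_simps)
  moreover have "y0\<^sup>2 * G\<^sup>2 = A * (G\<^sup>2 + 4 * A * M)" "y1\<^sup>2 * H\<^sup>2 = B * (H\<^sup>2 + 4 * B * M)"
    using G H unfolding circ s0 s1
    by (simp_all add: A_def B_def M_def field_simps power2_eq_square)
  ultimately have "(y0\<^sup>2 - y1\<^sup>2) * (G\<^sup>2 * H\<^sup>2) = M * K\<^sup>2 - G * K\<^sup>2"
    by algebra
  moreover have "(m + s0 - s1)\<^sup>2 * (G\<^sup>2 * H\<^sup>2) = M * K\<^sup>2"
    unfolding a using G H by (simp add: M_def power_divide power_mult_distrib)
  moreover have "G * K\<^sup>2 \<le> 0" using G by (simp add: mult_nonpos_nonneg)
  ultimately have "(m + s0 - s1)\<^sup>2 * (G\<^sup>2 * H\<^sup>2) \<le> (y0\<^sup>2 - y1\<^sup>2) * (G\<^sup>2 * H\<^sup>2)" by simp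
  then have "(m + s0 - s1)\<^sup>2 \<le> y0\<^sup>2 - y1\<^sup>2"
    using G H by (simp add: mult_le_cancel_right zero_less_mult_iff)
  then show "(m + s0 - s1)\<^sup>2 + y1\<^sup>2 \<le> y0\<^sup>2" by simp
qed

text \<open>\<open>D\<close> is the cosh of the distance between the feet, and
  \<open>y0 / q0\<close>, \<open>y1 / q1\<close> are the cosh of the two adjacent sides. Expressing
  everything through \<open>G\<close>, \<open>H\<close> and \<open>R\<close> makes the claims
  rational identities.\<close>

lemma disjoint_circles_common_perpendicular:
  fixes m s0 s1 y0 y1 q0 q1 :: real
  assumes pos: "q0 > 0" "q1 > 0" "y0 > 0" "y1 > 0"
    and circ: "y0\<^sup>2 = q0\<^sup>2 + s0\<^sup>2" "y1\<^sup>2 = q1\<^sup>2 + s1\<^sup>2"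
    and perp: "s0 * (m\<^sup>2 + q1\<^sup>2 - q0\<^sup>2) = 2 * q0\<^sup>2 * m" "s1 * (m\<^sup>2 + q0\<^sup>2 - q1\<^sup>2) = - 2 * q1\<^sup>2 * m"
    and good: "m\<^sup>2 + q1\<^sup>2 > q0\<^sup>2" "m\<^sup>2 + q0\<^sup>2 > q1\<^sup>2"
  defines "D \<equiv> (m\<^sup>2 + q0\<^sup>2 + q1\<^sup>2) / (2 * q0 * q1)"
  shows "y0 / q0 = (D + y0 / y1) / sqrt (D\<^sup>2 - 1)"
    and "y1 * sqrt ((y0 / q0)\<^sup>2 - 1) = y0 * sqrt ((y1 / q1)\<^sup>2 - 1)"
    and "\<bar>m + s0 - s1\<bar> = y1 * sqrt ((y0 / q0)\<^sup>2 - 1) * sqrt (D\<^sup>2 - 1)"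
    and "sqrt (D\<^sup>2 - 1) > 0"
proof -
  define A B M where "A = q0\<^sup>2" and "B = q1\<^sup>2" and "M = m\<^sup>2"
  define G H where "G = M + B - A" and "H = M + A - B"
  define K where "K = M\<^sup>2 + 2 * M * (A + B) + (A - B)\<^sup>2"
  define R where "R = sqrt K"
  have G: "G > 0" and H: "H > 0"
    using good by (auto simp: G_def H_def A_def B_def M_def)
  have ABM: "A > 0" "B > 0" "M > 0"
    using pos G H by (auto simp: A_def B_def M_def G_def H_def)
  have "K > 0" using ABM by (simp add: K_def add_pos_nonneg)
  then have R: "R > 0" "R\<^sup>2 = K" by (simp_all add: R_def)
  have s0: "s0 = 2 * A * m / G" and s1: "s1 = - 2 * B * m / H"
    using perp G H by (simp_all add: A_def B_def M_def G_def H_def field_simps)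
  have K: "G\<^sup>2 + 4 * A * M = K" "H\<^sup>2 + 4 * B * M = K"
    by (simp_all add: G_def H_def K_def power2_eq_square algebra_simps)
  have "y0\<^sup>2 = A * (G\<^sup>2 + 4 * A * M) / G\<^sup>2" "y1\<^sup>2 = B * (H\<^sup>2 + 4 * B * M) / H\<^sup>2"
    using G H unfolding circ s0 s1
    by (simp_all add: A_def B_def M_def field_simps power2_eq_square)
  then have "y0\<^sup>2 = (q0 * R / G)\<^sup>2" "y1\<^sup>2 = (q1 * R / H)\<^sup>2"
    unfolding K by (simp_all add: A_def B_def R(2) power_divide power_mult_distrib)
  \<comment> \<open>The signs of \<open>G\<close> and \<open>H\<close> select the roots; here it
    matters that the circles are not nested.\<close>
  then have y: "y0 = q0 * R / G" "y1 = q1 * R / H"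
    using pos R G H by (auto simp: power2_eq_iff_nonneg)
  have D2: "D\<^sup>2 - 1 = (R / (2 * q0 * q1))\<^sup>2"
  proof -
    have "(M + A + B)\<^sup>2 - 4 * A * B = K"
      by (simp add: K_def power2_eq_square algebra_simps)
    then show ?thesis
      using pos by (simp add: D_def power_divide power_mult_distrib R(2) A_def B_def M_def field_simps)
  qed
  then have D: "sqrt (D\<^sup>2 - 1) = R / (2 * q0 * q1)"
    using pos R by (simp add: real_sqrt_divide real_sqrt_mult)
  then show "sqrt (D\<^sup>2 - 1) > 0" using pos R by simp
  have sq: "sqrt ((y0 / q0)\<^sup>2 - 1) = \<bar>s0\<bar> / q0" "sqrt ((y1 / q1)\<^sup>2 - 1) = \<bar>s1\<bar> / q1"
    using pos by (simp_all add: power_divide circ diff_divide_distrib add_divide_distrib real_sqrt_divide)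
  \<comment> \<open>Numerator of \<open>D + y0 / y1\<close> over \<open>2 * q0 * q1 * G\<close>,
    because \<open>y0 / y1 = q0 * H / (q1 * G)\<close>.\<close>
  have e: "(M + A + B) * G + 2 * A * H = K"
    by (simp add: G_def H_def K_def power2_eq_square algebra_simps)
  have "D + y0 / y1 = ((M + A + B) * G + 2 * A * H) / (2 * q0 * q1 * G)"
    using pos R G H by (simp add: D_def y A_def B_def M_def field_simps power2_eq_square)
  also have "\<dots> = R\<^sup>2 / (2 * q0 * q1 * G)" by (simp add: e R)
  finally show "y0 / q0 = (D + y0 / y1) / sqrt (D\<^sup>2 - 1)"
    unfolding D using pos R(1) G by (simp add: y power2_eq_square)
  have as: "\<bar>s0\<bar> = 2 * A * \<bar>m\<bar> / G" "\<bar>s1\<bar> = 2 * B * \<bar>m\<bar> / H"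
    using G H ABM by (simp_all add: s0 s1 abs_mult)
  show "y1 * sqrt ((y0 / q0)\<^sup>2 - 1) = y0 * sqrt ((y1 / q1)\<^sup>2 - 1)"
    unfolding sq unfolding as y using pos by (simp add: A_def B_def power2_eq_square mult_ac)
  have "m * (G * H) + 2 * A * m * H + 2 * B * m * G = m * K"
    by (simp add: G_def H_def K_def power2_eq_square algebra_simps)
  then have "m + s0 - s1 = m * R\<^sup>2 / (G * H)"
    using G H by (simp add: s0 s1 R field_simps)
  then have "\<bar>m + s0 - s1\<bar> = \<bar>m\<bar> * R\<^sup>2 / (G * H)"
    using G H by (simp add: abs_mult)
  then show "\<bar>m + s0 - s1\<bar> = y1 * sqrt ((y0 / q0)\<^sup>2 - 1) * sqrt (D\<^sup>2 - 1)"
    unfolding sq unfolding as y D using pos by (simp add: A_def power2_eq_square mult_ac)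
qed

section \<open>The Cayley map to the upper half-plane\<close>

text \<open>For \<open>norm \<xi> = 1\<close> this takes the unit disc onto the upper half-plane,
  the centre to \<open>\<i>\<close> and \<open>\<xi>\<close> to infinity.\<close>

definition cayley :: "complex \<Rightarrow> complex \<Rightarrow> complex" where
  "cayley \<xi> z = \<i> * (\<xi> + z) / (\<xi> - z)"

context
  fixes \<xi> :: complex
  assumes norm_xi: "norm \<xi> = 1"
begin

lemma cnj_xi: "cnj \<xi> = inverse \<xi>"
  using norm_xi complex_norm_square[of \<xi>] by (intro inverse_unique[symmetric]) simp

lemma xi_nonzero: "\<xi> \<noteq> 0"
  using norm_xi by auto

lemma xi_neq: "norm z < 1 \<Longrightarrow> \<xi> - z \<noteq> 0"
  using norm_xi by auto

text \<open>The right-hand side is the Poisson kernel at \<open>\<xi>\<close>, whose level sets are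
  the horocycles centred there.\<close>

lemma Im_cayley:
  "norm z < 1 \<Longrightarrow> Im (cayley \<xi> z) = (1 - (norm z)\<^sup>2) / (norm (\<xi> - z))\<^sup>2"
proof -
  assume z: "norm z < 1"
  have "cayley \<xi> z = \<i> * ((\<xi> + z) / (\<xi> - z))" by (simp add: cayley_def)
  then have "Im (cayley \<xi> z) = Re ((\<xi> + z) * cnj (\<xi> - z)) / (norm (\<xi> - z))\<^sup>2"
    by (simp only: complex_div_cnj[of "\<xi> + z"] Im_i_times Re_divide_of_real of_real_power[symmetric])
  also have "Re ((\<xi> + z) * cnj (\<xi> - z)) = (norm \<xi>)\<^sup>2 - (norm z)\<^sup>2"
    unfolding cmod_power2 by (simp add: power2_eq_square algebra_simps)
  finally show ?thesis by (simp add: norm_xi)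
qed

lemma Im_cayley_pos: "norm z < 1 \<Longrightarrow> Im (cayley \<xi> z) > 0"
  using xi_neq[of z] by (simp add: Im_cayley abs_square_less_1)

lemma cayley_diff:
  assumes "norm z < 1" "norm w < 1"
  shows "cayley \<xi> z - cayley \<xi> w = 2 * \<i> * \<xi> * (z - w) / ((\<xi> - z) * (\<xi> - w))"
  using xi_neq[OF assms(1)] xi_neq[OF assms(2)] unfolding cayley_def
  by (simp add: field_simps)

lemma inj_cayley: "norm z < 1 \<Longrightarrow> norm w < 1 \<Longrightarrow> cayley \<xi> z = cayley \<xi> w \<longleftrightarrow> z = w"
  using cayley_diff[of z w] xi_nonzero xi_neq[of z] xi_neq[of w] by auto

text \<open>The preimage comes from the inverse Cayley map; it lies in the disc because
  \<open>Z\<close> is closer to \<open>\<i>\<close> than to \<open>- \<i>\<close>.\<close>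

lemma cayley_onto:
  assumes "Im Z > 0"
  obtains z where "norm z < 1" "cayley \<xi> z = Z"
proof -
  have nz: "Z + \<i> \<noteq> 0" using assms by (auto simp: complex_eq_iff)
  have "(norm (Z - \<i>))\<^sup>2 < (norm (Z + \<i>))\<^sup>2"
    using assms unfolding cmod_power2 by (simp add: power2_eq_square algebra_simps)
  then have "norm (Z - \<i>) < norm (Z + \<i>)"
    by (rule power2_less_imp_less) simp
  then have "norm (\<xi> * (Z - \<i>) / (Z + \<i>)) < 1"
    using nz by (simp add: norm_mult norm_divide norm_xi)
  moreover have "cayley \<xi> (\<xi> * (Z - \<i>) / (Z + \<i>)) = Z"
  proof -
    have "\<xi> + \<xi> * (Z - \<i>) / (Z + \<i>) = \<xi> * (2 * Z) / (Z + \<i>)"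
      using nz by (simp add: field_simps)
    moreover have "\<xi> - \<xi> * (Z - \<i>) / (Z + \<i>) = \<xi> * (2 * \<i>) / (Z + \<i>)"
      using nz by (simp add: field_simps)
    ultimately show ?thesis
      using nz xi_nonzero by (simp add: cayley_def)
  qed
  ultimately show ?thesis by (rule that)
qed

text \<open>The Cayley map is an isometry: the norms of \<open>\<xi> - z\<close> and
  \<open>\<xi> - w\<close> from \<open>cayley_diff\<close> and \<open>Im_cayley\<close>
  cancel.\<close>

lemma hdist_cayley:
  assumes "norm z < 1" "norm w < 1"
  shows "hdist z w = arcosh (1 + (norm (cayley \<xi> z - cayley \<xi> w))\<^sup>2
    / (2 * Im (cayley \<xi> z) * Im (cayley \<xi> w)))"
proof -
  have e: "4 * n / ((2 - 2 * a) * b) = 2 * n / ((1 - a) * b)" for n a b :: real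
    using mult_divide_mult_cancel_left[of 2 "2 * n" "(1 - a) * b"] by (simp add: algebra_simps)
  from xi_neq[OF assms(1)] xi_neq[OF assms(2)] show ?thesis
    by (simp add: hdist_def cayley_diff[OF assms] Im_cayley assms norm_mult norm_divide norm_xi
        power_mult_distrib power_divide e)
qed

text \<open>Both sides move \<open>p\<close> to the centre, so they differ by a rotation
  \<open>u\<close> independent of \<open>q\<close>. The half-plane quotient tends to 1 at infinity,
  which identifies \<open>u\<close> as the value at \<open>\<xi>\<close>.\<close>

lemma moebius_cayley:
  assumes p: "norm p < 1"
  obtains u where "norm u = 1" "Moebius_function 0 p \<xi> = u"
    "\<And>q. norm q < 1 \<Longrightarrow> Moebius_function 0 p q
       = u * ((cayley \<xi> q - cayley \<xi> p) / (cayley \<xi> q - cnj (cayley \<xi> p)))"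
proof
  let ?u = "Moebius_function 0 p \<xi>"
  have np: "1 - cnj p * \<xi> \<noteq> 0" using norm_lt_1_imp_moebius_denom[OF p] norm_xi by simp
  have "norm (1 - cnj p * \<xi>) = norm (\<xi> * cnj (\<xi> - p))"
    using xi_nonzero by (simp add: cnj_xi algebra_simps)
  also have "\<dots> = norm (\<xi> - p)" by (simp add: norm_mult norm_xi del: complex_cnj_diff)
  finally show "norm ?u = 1"
    using np xi_neq[OF p] by (simp add: Moebius_function_simple norm_divide)
  show "?u = ?u" ..
  fix q :: complex assume q: "norm q < 1"
  have nq: "1 - cnj p * q \<noteq> 0" using norm_lt_1_imp_moebius_denom[OF p] q by simp
  have np': "inverse \<xi> - cnj p \<noteq> 0" using np xi_nonzero by (auto simp: field_simps)
  have "cnj (cayley \<xi> p) = - \<i> * (1 + cnj p * \<xi>) / (1 - cnj p * \<xi>)"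
    using np xi_nonzero np' by (simp add: cayley_def cnj_xi field_simps)
  then have cnj_p: "cayley \<xi> q - cnj (cayley \<xi> p)
      = \<i> * (\<xi> + q) / (\<xi> - q) + \<i> * (1 + cnj p * \<xi>) / (1 - cnj p * \<xi>)"
    by (simp add: cayley_def[of \<xi> q])
  have "cayley \<xi> q - cnj (cayley \<xi> p)
      = 2 * \<i> * \<xi> * (1 - cnj p * q) / ((\<xi> - q) * (1 - cnj p * \<xi>))"
    unfolding cnj_p using np xi_neq[OF q] by (simp add: field_simps)
  then show "Moebius_function 0 p q
      = ?u * ((cayley \<xi> q - cayley \<xi> p) / (cayley \<xi> q - cnj (cayley \<xi> p)))"
    using np nq xi_neq[OF q] xi_neq[OF p] xi_nonzero
    by (simp add: cayley_diff[OF q p] Moebius_function_simple)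
qed

lemma cayley_cnj_nonzero:
  assumes "norm p < 1" "norm q < 1"
  shows "cayley \<xi> q - cnj (cayley \<xi> p) \<noteq> 0"
  using Im_cayley_pos[OF assms(1)] Im_cayley_pos[OF assms(2)] by (auto simp: complex_eq_iff)

section \<open>Right angles and sides in half-plane coordinates\<close>

text \<open>Up to rotation and a positive factor, the direction from \<open>P\<close> to
  \<open>Q\<close> is \<open>(Q - P) * cnj (Q - cnj P)\<close>. With \<open>x = Re Q - Re P\<close>
  its coordinates are \<open>x\<^sup>2 + (Im Q)\<^sup>2 - (Im P)\<^sup>2\<close> and
  \<open>- 2 * x * Im P\<close>; the equation is the inner product of two such vectors.\<close>

lemma right_angle_cayley:
  assumes "norm p < 1" "norm q < 1" "norm r < 1" "hangle q p r = pi / 2"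
  defines "P \<equiv> cayley \<xi> p" and "Q \<equiv> cayley \<xi> q" and "R \<equiv> cayley \<xi> r"
  shows "((Re Q - Re P)\<^sup>2 + (Im Q)\<^sup>2 - (Im P)\<^sup>2) * ((Re R - Re P)\<^sup>2 + (Im R)\<^sup>2 - (Im P)\<^sup>2)
    + 4 * (Re Q - Re P) * (Re R - Re P) * (Im P)\<^sup>2 = 0"
proof -
  obtain u where u: "norm u = 1" and M: "\<And>q. norm q < 1 \<Longrightarrow> Moebius_function 0 p q
       = u * ((cayley \<xi> q - cayley \<xi> p) / (cayley \<xi> q - cnj (cayley \<xi> p)))"
    using moebius_cayley[OF assms(1)] by blast
  have "Re (((Q - P) * cnj (Q - cnj P)) * cnj ((R - P) * cnj (R - cnj P))) = 0"
    using hangle_right_imp_orthogonal[OF assms(1,4)] u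
      cayley_cnj_nonzero[OF assms(1,2)] cayley_cnj_nonzero[OF assms(1,3)]
    unfolding M[OF assms(2)] M[OF assms(3)] P_def Q_def R_def
    by (subst (asm) inner_right_angle_iff) auto
  then show ?thesis by (simp add: power2_eq_square algebra_simps)
qed

text \<open>In the same frame the direction towards \<open>\<xi>\<close> is 1, so the real part of
  the other direction vanishes. This puts \<open>R\<close> on the circle of radius
  \<open>Im P\<close> around \<open>Re P\<close>.\<close>

lemma right_angle_ideal_cayley:
  assumes "norm p < 1" "norm r < 1" "hangle \<xi> p r = pi / 2"
  defines "P \<equiv> cayley \<xi> p" and "R \<equiv> cayley \<xi> r"
  shows "(Im P)\<^sup>2 = (Im R)\<^sup>2 + (Re R - Re P)\<^sup>2"
proof -
  obtain u where u: "norm u = 1" "Moebius_function 0 p \<xi> = u"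
    and M: "\<And>q. norm q < 1 \<Longrightarrow> Moebius_function 0 p q
       = u * ((cayley \<xi> q - cayley \<xi> p) / (cayley \<xi> q - cnj (cayley \<xi> p)))"
    using moebius_cayley[OF assms(1)] by blast
  have "(u * (1 / 1)) \<bullet> (u * ((R - P) / (R - cnj P))) = 0"
    using hangle_right_imp_orthogonal[OF assms(1,3)] u
    unfolding M[OF assms(2)] P_def R_def by simp
  then have "Re ((1 * cnj 1) * cnj ((R - P) * cnj (R - cnj P))) = 0"
    using u cayley_cnj_nonzero[OF assms(1,2)] unfolding P_def R_def
    by (subst (asm) inner_right_angle_iff) auto
  then show ?thesis by (simp add: power2_eq_square algebra_simps)
qed

text \<open>On the vertical line the Moebius quotient at height \<open>b\<close> is the real number
  \<open>(b - y) / (b + y)\<close>, which serves as the parameter of the ray.\<close>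

lemma mem_hside_ideal:
  assumes p: "norm p < 1" and z: "norm z < 1"
    and "Re (cayley \<xi> z) = Re (cayley \<xi> p)" "Im (cayley \<xi> z) \<ge> Im (cayley \<xi> p)"
  shows "z \<in> hside p \<xi>"
proof -
  define y b where "y = Im (cayley \<xi> p)" and "b = Im (cayley \<xi> z)"
  have y: "y > 0" "b \<ge> y" using assms Im_cayley_pos[OF p] by (auto simp: y_def b_def)
  obtain u where u: "norm u = 1" "Moebius_function 0 p \<xi> = u"
    and M: "\<And>q. norm q < 1 \<Longrightarrow> Moebius_function 0 p q
       = u * ((cayley \<xi> q - cayley \<xi> p) / (cayley \<xi> q - cnj (cayley \<xi> p)))"
    using moebius_cayley[OF p] by blast
  have "cayley \<xi> z - cayley \<xi> p = \<i> * of_real (b - y)"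
    "cayley \<xi> z - cnj (cayley \<xi> p) = \<i> * of_real (b + y)"
    using assms(3) by (auto simp: complex_eq_iff b_def y_def)
  then have "Moebius_function 0 p z = of_real ((b - y) / (b + y)) * Moebius_function 0 p \<xi>"
    using y by (simp add: M[OF z] u(2) del: of_real_add of_real_diff)
  then show ?thesis
    using y by (intro mem_hside[OF p z, of "(b - y) / (b + y)"]) auto
qed

lemma hside_ideal_Re:
  assumes p: "norm p < 1" and z: "z \<in> hside p \<xi>"
  shows "Re (cayley \<xi> z) = Re (cayley \<xi> p)"
proof -
  have z1: "norm z < 1" using z by (auto simp: hside_def hplane_def)
  obtain u where u: "norm u = 1" "Moebius_function 0 p \<xi> = u"
    and M: "\<And>q. norm q < 1 \<Longrightarrow> Moebius_function 0 p q
       = u * ((cayley \<xi> q - cayley \<xi> p) / (cayley \<xi> q - cnj (cayley \<xi> p)))"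
    using moebius_cayley[OF p] by blast
  obtain t where "Moebius_function 0 p z = of_real t * u"
    using hsideE[OF z p] u(2) by metis
  then have "u * (cayley \<xi> z - cayley \<xi> p) = u * (of_real t * (cayley \<xi> z - cnj (cayley \<xi> p)))"
    using cayley_cnj_nonzero[OF p z1] M[OF z1] by (simp add: field_simps)
  then have "cayley \<xi> z - cayley \<xi> p = of_real t * (cayley \<xi> z - cnj (cayley \<xi> p))"
    using u(1) by (metis mult_left_cancel norm_zero zero_neq_one)
  then have e: "Re (cayley \<xi> z) - Re (cayley \<xi> p) = t * (Re (cayley \<xi> z) - Re (cayley \<xi> p))"
    "Im (cayley \<xi> z) - Im (cayley \<xi> p) = t * (Im (cayley \<xi> z) + Im (cayley \<xi> p))"
    by (auto simp: complex_eq_iff)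
  \<comment> \<open>The parameter 1 belongs to the ideal endpoint; it would force
    \<open>Im (cayley \<xi> p) = 0\<close>.\<close>
  have "t \<noteq> 1" using e(2) Im_cayley_pos[OF p] by auto
  moreover have "(1 - t) * (Re (cayley \<xi> z) - Re (cayley \<xi> p)) = 0"
    using e(1) by (simp add: algebra_simps)
  ultimately show ?thesis by simp
qed

text \<open>
  A point \<open>Z\<close> of the circle orthogonal to the vertical ray at \<open>P\<close> satisfies
  \<open>(Z - P) / (Z - cnj P) = - \<i> (Re Z - Re P) / (Im Z + Im P)\<close>.
\<close>

lemma mem_hside_circle:
  assumes p: "norm p < 1" and z: "norm z < 1" and q: "norm q < 1"
  defines "P \<equiv> cayley \<xi> p" and "Z \<equiv> cayley \<xi> z" and "Q \<equiv> cayley \<xi> q"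
  assumes Zc: "(Im P)\<^sup>2 = (Im Z)\<^sup>2 + (Re Z - Re P)\<^sup>2" and Qc: "(Im P)\<^sup>2 = (Im Q)\<^sup>2 + (Re Q - Re P)\<^sup>2"
    and sgn: "(Re Z - Re P) * (Re Q - Re P) \<ge> 0" and le: "(Re Z - Re P)\<^sup>2 \<le> (Re Q - Re P)\<^sup>2"
    and ne: "Re Q \<noteq> Re P"
  shows "z \<in> hside p q"
proof -
  define s a where "s = Re Q - Re P" and "a = Re Z - Re P"
  have pos: "Im P > 0" "Im Z > 0" "Im Q > 0"
    using Im_cayley_pos assms by (auto simp: P_def Z_def Q_def)
  have on_circle: "(W - P) / (W - cnj P) = - \<i> * of_real ((Re W - Re P) / (Im W + Im P))"
    if "(Im P)\<^sup>2 = (Im W)\<^sup>2 + (Re W - Re P)\<^sup>2" "Im W > 0" for W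
  proof -
    have "W - P = - \<i> * of_real ((Re W - Re P) / (Im W + Im P)) * (W - cnj P)"
      using that pos by (simp add: complex_eq_iff field_simps power2_eq_square)
    moreover have "W - cnj P \<noteq> 0" using that pos by (auto simp: complex_eq_iff)
    ultimately show ?thesis by (simp add: field_simps)
  qed
  obtain u where M: "\<And>q. norm q < 1 \<Longrightarrow> Moebius_function 0 p q
       = u * ((cayley \<xi> q - P) / (cayley \<xi> q - cnj P))"
    using moebius_cayley[OF p] unfolding P_def by blast
  have MZ: "Moebius_function 0 p z = u * (- \<i> * of_real (a / (Im Z + Im P)))"
    and MQ: "Moebius_function 0 p q = u * (- \<i> * of_real (s / (Im Q + Im P)))"
    using M[OF z] M[OF q] on_circle[OF Zc pos(2)] on_circle[OF Qc pos(3)]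
    by (simp_all only: a_def s_def Z_def[symmetric] Q_def[symmetric])
  \<comment> \<open>On the circle, the point horizontally closer to the centre is higher.\<close>
  have "(Im Q)\<^sup>2 \<le> (Im Z)\<^sup>2" using Zc Qc le by simp
  then have QZ: "Im Q \<le> Im Z" using pos by (simp add: power2_le_iff_abs_le)
  have s: "s \<noteq> 0" using ne by (simp add: s_def)
  \<comment> \<open>The ratio of the two Moebius values, split into factors that each lie between 0
    and 1.\<close>
  define t where "t = (a / s) * ((Im Q + Im P) / (Im Z + Im P))"
  have "a / s = a * s / s\<^sup>2" using s by (simp add: power2_eq_square)
  also have "\<dots> \<ge> 0" using sgn by (simp add: a_def s_def)
  finally have "a / s \<ge> 0" .
  have "\<bar>a\<bar> \<le> \<bar>s\<bar>" using le by (simp add: a_def s_def abs_le_square_iff)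
  then have "\<bar>a / s\<bar> \<le> 1" using s by simp
  then have as: "0 \<le> a / s" "a / s \<le> 1" using \<open>a / s \<ge> 0\<close> by (simp_all only: abs_of_nonneg)
  have fr: "(Im Q + Im P) / (Im Z + Im P) \<le> 1" "(Im Q + Im P) / (Im Z + Im P) \<ge> 0"
    using pos QZ by auto
  have "t \<in> {0..1}"
    unfolding t_def atLeastAtMost_iff
    using mult_nonneg_nonneg[OF as(1) fr(2)] mult_le_one[OF as(2) fr(2,1)] by blast
  moreover have "Moebius_function 0 p z = of_real t * Moebius_function 0 p q"
  proof -
    have "a / (Im Z + Im P) = t * (s / (Im Q + Im P))"
      using s pos by (simp add: t_def)
    then show ?thesis unfolding MZ MQ by simp
  qed
  ultimately show ?thesis by (intro mem_hside[OF p z])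
qed

section \<open>Horoballs, signed distances and horocyclic arcs\<close>

lemma horoball_cayley:
  assumes "horoball \<xi> B"
  obtains h where "h > 0" "horosphere B = {z. norm z < 1 \<and> Im (cayley \<xi> z) = h}"
    "\<And>z. norm z < 1 \<Longrightarrow> z \<in> interior B \<longleftrightarrow> Im (cayley \<xi> z) > h"
proof -
  obtain \<rho> where \<rho>: "0 < \<rho>" "\<rho> < 1" and B: "B = cball (of_real (1 - \<rho>) * \<xi>) \<rho> - {\<xi>}"
    using assms unfolding horoball_def by blast
  define c where "c = of_real (1 - \<rho>) * \<xi>"
  have B': "B = cball c \<rho> - {\<xi>}" by (simp add: B c_def)
  \<comment> \<open>The height of \<open>(1 - 2 * \<rho>) * \<xi>\<close>, the point of the
    horocycle opposite \<open>\<xi>\<close>.\<close>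
  define h where "h = (1 - \<rho>) / \<rho>"
  have "c - \<xi> = - of_real \<rho> * \<xi>" by (simp add: c_def algebra_simps)
  then have "dist c \<xi> = \<rho>" using \<rho> by (simp add: dist_norm norm_mult norm_xi)
  then have xi: "\<xi> \<notin> ball c \<rho>" by simp
  then have int: "interior B = ball c \<rho>"
    by (auto simp: B' interior_diff)
  have "closure B = cball c \<rho>"
  proof
    show "closure B \<subseteq> cball c \<rho>" by (rule closure_minimal) (auto simp: B')
    have "closure (ball c \<rho>) \<subseteq> closure B" using int interior_subset by (metis closure_mono)
    then show "cball c \<rho> \<subseteq> closure B" using \<rho> by simp
  qed
  then have fr: "frontier B = sphere c \<rho>" by (simp add: frontier_def int cball_diff_eq_sphere)
  \<comment> \<open>The power of \<open>z\<close> with respect to the circle is a positive multiple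
    of \<open>h - Im (cayley \<xi> z)\<close>, so its sign decides both membership claims.\<close>
  have diff: "(dist c z)\<^sup>2 - \<rho>\<^sup>2 = \<rho> * (norm (\<xi> - z))\<^sup>2 * (h - Im (cayley \<xi> z))" if z: "norm z < 1" for z
  proof -
    have "c = (1 - \<rho>) *\<^sub>R \<xi>" by (simp only: c_def scaleR_conv_of_real)
    then have "c \<bullet> z = (1 - \<rho>) * (\<xi> \<bullet> z)" "norm c = 1 - \<rho>"
      using \<rho> by (simp_all add: norm_xi)
    then have "(norm (c - z))\<^sup>2 = (1 - \<rho>)\<^sup>2 + (norm z)\<^sup>2 - (1 - \<rho>) * (1 + (norm z)\<^sup>2 - (norm (\<xi> - z))\<^sup>2)"
      using dot_norm_neg[of c z] dot_norm_neg[of \<xi> z] by (simp add: norm_xi)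
    then have "(dist c z)\<^sup>2 - \<rho>\<^sup>2 = (1 - \<rho>) * (norm (\<xi> - z))\<^sup>2 - \<rho> * (1 - (norm z)\<^sup>2)"
      by (simp add: dist_norm power2_eq_square algebra_simps)
    also have "1 - (norm z)\<^sup>2 = Im (cayley \<xi> z) * (norm (\<xi> - z))\<^sup>2"
      using xi_neq[OF z] by (simp add: Im_cayley z)
    also have "(1 - \<rho>) = \<rho> * h" using \<rho> by (simp add: h_def)
    finally show ?thesis by (simp add: algebra_simps)
  qed
  have pos: "\<rho> * (norm (\<xi> - z))\<^sup>2 > 0" if "norm z < 1" for z
    using \<rho> xi_neq[OF that] by simp
  show ?thesis
  proof
    show "h > 0" using \<rho> by (simp add: h_def)
    have "dist c z = \<rho> \<longleftrightarrow> Im (cayley \<xi> z) = h" if "norm z < 1" for z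
      using diff[OF that] pos[OF that] \<rho> power2_eq_iff_nonneg[of "dist c z" \<rho>] by auto
    then show "horosphere B = {z. norm z < 1 \<and> Im (cayley \<xi> z) = h}"
      by (auto simp: horosphere_def hplane_def fr)
    fix z :: complex assume z: "norm z < 1"
    have "z \<in> interior B \<longleftrightarrow> (dist c z)\<^sup>2 - \<rho>\<^sup>2 < 0"
      using \<rho> by (simp add: int power_mono_iff abs_less_iff power2_less_imp_less
          power_strict_mono linorder_not_le[symmetric])
    also have "\<dots> \<longleftrightarrow> Im (cayley \<xi> z) > h"
      unfolding diff[OF z] using pos[OF z] by (simp add: mult_less_0_iff zero_less_mult_iff)
    finally show "z \<in> interior B \<longleftrightarrow> Im (cayley \<xi> z) > h" .
  qed
qed

text \<open>The nearest point of the horizontal line is on the vertical through \<open>v\<close>, at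
  distance \<open>\<bar>ln (h / y)\<bar>\<close>. The interior test supplies exactly the sign of the
  logarithm.\<close>

lemma signed_hdist_cayley:
  assumes v: "norm v < 1" and h: "h > 0"
    and S: "horosphere B = {z. norm z < 1 \<and> Im (cayley \<xi> z) = h}"
    and int: "\<And>z. norm z < 1 \<Longrightarrow> z \<in> interior B \<longleftrightarrow> Im (cayley \<xi> z) > h"
  shows "signed_hdist v B = ln (h / Im (cayley \<xi> v))"
proof -
  define y where "y = Im (cayley \<xi> v)"
  have y: "y > 0" using Im_cayley_pos[OF v] by (simp add: y_def)
  have cosh: "1 + (y - h)\<^sup>2 / (2 * y * h) = cosh (ln (h / y))"
    using y h by (simp add: cosh_ln_real field_simps power2_eq_square)
  have min: "arcosh (1 + (y - h)\<^sup>2 / (2 * y * h)) = \<bar>ln (h / y)\<bar>"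
    unfolding cosh by (metis abs_ge_zero arcosh_cosh_real cosh_real_abs)
  have dist: "hdist v s = arcosh (1 + ((Re (cayley \<xi> v) - Re (cayley \<xi> s))\<^sup>2 + (y - h)\<^sup>2) / (2 * y * h))"
    if "s \<in> horosphere B" for s
    using that v by (simp add: S hdist_cayley cmod_power2 y_def)
  have "(INF s\<in>horosphere B. hdist v s) = \<bar>ln (h / y)\<bar>"
  proof (rule cInf_eq_minimum)
    obtain s where "norm s < 1" "cayley \<xi> s = Complex (Re (cayley \<xi> v)) h"
      using cayley_onto[of "Complex (Re (cayley \<xi> v)) h"] h by auto
    then have "s \<in> horosphere B" "hdist v s = \<bar>ln (h / y)\<bar>"
      using dist[of s] min by (auto simp: S)
    then show "\<bar>ln (h / y)\<bar> \<in> hdist v ` horosphere B" by force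
    fix d assume "d \<in> hdist v ` horosphere B"
    then obtain r where "d = arcosh (1 + (r\<^sup>2 + (y - h)\<^sup>2) / (2 * y * h))"
      using dist by auto
    moreover have "arcosh (1 + (y - h)\<^sup>2 / (2 * y * h)) \<le> arcosh (1 + (r\<^sup>2 + (y - h)\<^sup>2) / (2 * y * h))"
      unfolding not_less[symmetric] using y h
      by (subst arcosh_less_iff_real) (auto simp: not_less divide_right_mono)
    ultimately show "\<bar>ln (h / y)\<bar> \<le> d" using min by simp
  qed
  moreover have "v \<in> interior B \<longleftrightarrow> h < y" using int[OF v] by (simp add: y_def)
  ultimately show ?thesis
    using y h unfolding signed_hdist_def y_def[symmetric] by (simp add: ln_div)
qed

lemma cayley_has_field_derivative:
  "norm z < 1 \<Longrightarrow> (cayley \<xi> has_field_derivative 2 * \<i> * \<xi> / (\<xi> - z)\<^sup>2) (at z)"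
  unfolding cayley_def[abs_def] using xi_neq[of z]
  by (auto intro!: derivative_eq_intros simp: field_simps power2_eq_square)

text \<open>At constant height \<open>h\<close> the length element is
  \<open>\<bar>dX\<bar> / h\<close>. An arc is injective, so \<open>X\<close> is monotone and the
  integral telescopes.\<close>

lemma hlength_horocycle:
  assumes "valid_path g" "arc g" "h > 0"
    and im: "path_image g \<subseteq> {z. norm z < 1 \<and> Im (cayley \<xi> z) = h}"
  shows "hlength g = \<bar>Re (cayley \<xi> (pathfinish g)) - Re (cayley \<xi> (pathstart g))\<bar> / h"
proof -
  define X where "X = (\<lambda>t. Re (cayley \<xi> (g t)))"
  have g: "norm (g t) < 1" "Im (cayley \<xi> (g t)) = h" if "t \<in> {0..1}" for t
    using subsetD[OF im, of "g t"] that by (auto simp: path_image_def)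
  have contg: "continuous_on {0..1} g"
    using valid_path_imp_path[OF assms(1)] by (simp add: path_def)
  have contX: "continuous_on {0..1} X"
    unfolding X_def cayley_def using xi_neq g(1) contg by (intro continuous_intros) auto
  have "inj_on X {0..1}"
  proof (rule inj_onI)
    fix t t' assume t: "t \<in> {0..1}" "t' \<in> {0..1}" "X t = X t'"
    then have "cayley \<xi> (g t) = cayley \<xi> (g t')" using g by (simp add: X_def complex_eq_iff)
    then have "g t = g t'" using g t inj_cayley by simp
    then show "t = t'" using assms(2) t by (auto simp: arc_def inj_on_def)
  qed
  then have "strict_mono_on {0..1} X \<or> strict_antimono_on {0..1} X"
    using contX injective_eq_monotone_map[of "{0..1}" X] by (simp add: is_interval_cc)
  \<comment> \<open>\<open>\<sigma>\<close> records the direction of travel, so that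
    \<open>\<sigma> * X\<close> is increasing.\<close>
  then obtain \<sigma> :: real where \<sigma>: "\<bar>\<sigma>\<bar> = 1" "mono_on {0..1} (\<lambda>t. \<sigma> * X t)"
  proof
    assume "strict_mono_on {0..1} X"
    then show ?thesis using that[of 1] by (simp add: strict_mono_on_imp_mono_on)
  next
    assume a: "strict_antimono_on {0..1} X"
    have "mono_on {0..1} (\<lambda>t. - 1 * X t)"
    proof (rule mono_onI)
      fix r s :: real assume "r \<in> {0..1}" "s \<in> {0..1}" "r \<le> s"
      then show "- 1 * X r \<le> - 1 * X s"
        using a by (cases "r = s") (auto simp: monotone_on_def less_imp_le)
    qed
    then show ?thesis using that[of "-1"] by simp
  qed
  obtain N where N: "finite N" "g C1_differentiable_on ({0..1} - N)"
    using assms(1) unfolding valid_path_def piecewise_C1_differentiable_on_def by blast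
  define f where "f = (\<lambda>t. 2 * norm (vector_derivative g (at t)) / (1 - (norm (g t))\<^sup>2))"
  have deriv: "((\<lambda>t. \<sigma> * X t / h) has_vector_derivative f t) (at t)" if t: "t \<in> {0<..<1} - N" for t
  proof -
    have t01: "t \<in> {0..1}" using t by auto
    have gt: "norm (g t) < 1" by (rule g[OF t01])
    let ?g' = "vector_derivative g (at t)"
    have "(g has_vector_derivative ?g') (at t)"
      using N(2) t by (auto simp: C1_differentiable_on_eq vector_derivative_works[symmetric])
    from field_vector_diff_chain_at[OF this cayley_has_field_derivative[OF gt]]
    obtain F where F: "((\<lambda>t. cayley \<xi> (g t)) has_vector_derivative F) (at t)"
      and F_eq: "F = ?g' * (2 * \<i> * \<xi> / (\<xi> - g t)\<^sup>2)"
      by (simp add: o_def)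
    have ReF: "(X has_vector_derivative Re F) (at t)"
      using bounded_linear.has_vector_derivative[OF bounded_linear_Re F] by (simp add: X_def)
    \<comment> \<open>The height is constant, hence the velocity \<open>F\<close> in the half-plane
      is horizontal.\<close>
    have "((\<lambda>t. Im (cayley \<xi> (g t))) has_vector_derivative Im F) (at t)"
      using bounded_linear.has_vector_derivative[OF bounded_linear_Im F] .
    moreover have "((\<lambda>t. Im (cayley \<xi> (g t))) has_vector_derivative 0) (at t)"
    proof (rule has_vector_derivative_transform_within_open)
      show "((\<lambda>_. h) has_vector_derivative 0) (at t)" by simp
      show "t \<in> {0<..<1}" using t by simp
      show "h = Im (cayley \<xi> (g s))" if "s \<in> {0<..<1}" for s
        using that g(2)[of s] by simp
    qed simp
    ultimately have "Im F = 0" by (rule vector_derivative_unique_at)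
    then have normF: "norm F = \<bar>Re F\<bar>" by (simp add: cmod_eq_Re)
    have \<sigma>F: "((\<lambda>t. \<sigma> * X t) has_real_derivative \<sigma> * Re F) (at t)"
      using ReF by (auto simp: has_real_derivative_iff_has_vector_derivative[symmetric]
          intro!: derivative_eq_intros)
    have "\<sigma> * Re F \<ge> 0"
      using t by (intro mono_on_imp_deriv_nonneg[OF \<sigma>(2) \<sigma>F]) (auto simp: interior_cbox)
    then have "\<sigma> * Re F = \<bar>\<sigma> * Re F\<bar>" by simp
    also have "\<dots> = norm F" using \<sigma>(1) normF by (simp add: abs_mult)
    also have "\<dots> = 2 * norm ?g' / (norm (\<xi> - g t))\<^sup>2"
      by (simp add: F_eq norm_mult norm_divide norm_power norm_xi)
    also have "\<dots> = f t * Im (cayley \<xi> (g t))"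
      using gt by (simp add: f_def Im_cayley abs_square_less_1 less_imp_neq)
    also have "Im (cayley \<xi> (g t)) = h" by (rule g[OF t01])
    finally have "\<sigma> * Re F / h = f t" using assms(3) by simp
    moreover have "((\<lambda>t. \<sigma> * X t / h) has_real_derivative \<sigma> * Re F / h) (at t)"
      by (rule DERIV_cdivide[OF \<sigma>F])
    ultimately show ?thesis by (simp add: has_real_derivative_iff_has_vector_derivative)
  qed
  \<comment> \<open>The fundamental theorem tolerates the finitely many break points
    \<open>N\<close> and also yields integrability of \<open>f\<close>.\<close>
  have "(f has_integral (\<sigma> * X 1 / h - \<sigma> * X 0 / h)) {0..1}"
    by (rule fundamental_theorem_of_calculus_interior_strong[OF N(1)])
      (use deriv contX assms(3) in \<open>auto intro!: continuous_intros\<close>)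
  then have "hlength g = \<sigma> * X 1 / h - \<sigma> * X 0 / h"
    unfolding hlength_def f_def by (rule integral_unique)
  also have "\<dots> = \<bar>X 1 - X 0\<bar> / h"
  proof -
    have "\<sigma> * X 0 \<le> \<sigma> * X 1" using mono_onD[OF \<sigma>(2), of 0 1] by simp
    then have "\<sigma> * X 1 - \<sigma> * X 0 = \<bar>\<sigma> * (X 1 - X 0)\<bar>" by (simp add: right_diff_distrib)
    also have "\<dots> = \<bar>X 1 - X 0\<bar>" by (simp add: abs_mult \<sigma>(1))
    finally show ?thesis by (simp flip: diff_divide_distrib)
  qed
  finally show ?thesis by (simp add: X_def pathstart_def pathfinish_def)
qed

section \<open>Configurations of two right-angled sides\<close>

text \<open>The angle at \<open>v\<close> gives the circle equation. Substituted into the condition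
  at \<open>w\<close>, it lets the factor \<open>2 * s\<close> split off, and \<open>s = 0\<close>
  would mean \<open>v = w\<close>.\<close>

lemma right_angles_imp_perp:
  assumes n: "norm v < 1" "norm w < 1" "norm w' < 1" and "v \<noteq> w"
    and ang: "hangle \<xi> v w = pi / 2" "hangle v w w' = pi / 2"
  defines "s \<equiv> Re (cayley \<xi> w) - Re (cayley \<xi> v)" and "m \<equiv> Re (cayley \<xi> w') - Re (cayley \<xi> w)"
    and "y \<equiv> Im (cayley \<xi> v)" and "q \<equiv> Im (cayley \<xi> w)" and "q' \<equiv> Im (cayley \<xi> w')"
  shows "y\<^sup>2 = q\<^sup>2 + s\<^sup>2" "s \<noteq> 0" "s * (m\<^sup>2 + q'\<^sup>2 - q\<^sup>2) = 2 * q\<^sup>2 * m"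
proof -
  show c: "y\<^sup>2 = q\<^sup>2 + s\<^sup>2"
    using right_angle_ideal_cayley[OF n(1,2) ang(1)] by (simp add: s_def y_def q_def)
  show s: "s \<noteq> 0"
  proof
    assume "s = 0"
    moreover have "y > 0" "q > 0" using Im_cayley_pos n by (auto simp: y_def q_def)
    ultimately have "y = q" using c by (simp add: power2_eq_iff_nonneg)
    with \<open>s = 0\<close> have "cayley \<xi> v = cayley \<xi> w" by (simp add: complex_eq_iff s_def y_def q_def)
    then show False using inj_cayley n \<open>v \<noteq> w\<close> by simp
  qed
  have "((- s)\<^sup>2 + y\<^sup>2 - q\<^sup>2) * (m\<^sup>2 + q'\<^sup>2 - q\<^sup>2) + 4 * (- s) * m * q\<^sup>2 = 0"
    using right_angle_cayley[OF n(2,1,3) ang(2)] by (simp add: s_def y_def q_def q'_def m_def)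
  then have "2 * s * (s * (m\<^sup>2 + q'\<^sup>2 - q\<^sup>2) - 2 * q\<^sup>2 * m) = 0"
    using c by algebra
  then show "s * (m\<^sup>2 + q'\<^sup>2 - q\<^sup>2) = 2 * q\<^sup>2 * m" using s by simp
qed

text \<open>A vertical geodesic is orthogonal to the circle only at its top, which is
  \<open>v\<close> and not \<open>w\<close>.\<close>

lemma perp_feet_distinct:
  assumes n: "norm v < 1" "norm w < 1" "norm w' < 1" and "v \<noteq> w" "w \<noteq> w'"
    and ang: "hangle \<xi> v w = pi / 2" "hangle v w w' = pi / 2"
  shows "Re (cayley \<xi> w') \<noteq> Re (cayley \<xi> w)"
proof
  assume m: "Re (cayley \<xi> w') = Re (cayley \<xi> w)"
  then have "(Im (cayley \<xi> w'))\<^sup>2 = (Im (cayley \<xi> w))\<^sup>2"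
    using right_angles_imp_perp[OF n \<open>v \<noteq> w\<close> ang] by simp
  then have "cayley \<xi> w = cayley \<xi> w'"
    using m Im_cayley_pos n by (auto simp: complex_eq_iff power2_eq_iff_nonneg less_imp_le)
  then show False using inj_cayley n \<open>w \<noteq> w'\<close> by simp
qed

text \<open>The first two inequalities of \<open>nested_circles_common_perpendicular\<close> make
  the vertical line through \<open>v'\<close> cross the arc from \<open>v\<close> to
  \<open>w\<close>; the third puts the crossing no lower than \<open>v'\<close>, hence on the
  ray.\<close>

lemma nested_sides_meet:
  assumes n: "norm v < 1" "norm w < 1" "norm w' < 1" "norm v' < 1"
    and ne: "v \<noteq> w" "w \<noteq> w'" "v' \<noteq> w'"
    and ang: "hangle \<xi> v w = pi / 2" "hangle v w w' = pi / 2"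
      "hangle \<xi> v' w' = pi / 2" "hangle v' w' w = pi / 2"
    and nested: "(Re (cayley \<xi> w') - Re (cayley \<xi> w))\<^sup>2 + (Im (cayley \<xi> w'))\<^sup>2 < (Im (cayley \<xi> w))\<^sup>2"
  shows "hside v w \<inter> hside v' \<xi> \<noteq> {}"
proof -
  define V V' W W' where "V = cayley \<xi> v" and "V' = cayley \<xi> v'"
    and "W = cayley \<xi> w" and "W' = cayley \<xi> w'"
  note defs = V_def V'_def W_def W'_def
  define m s s' where "m = Re W' - Re W" and "s = Re W - Re V" and "s' = Re W' - Re V'"
  have pos: "Im V > 0" "Im V' > 0" "Im W > 0" "Im W' > 0"
    using Im_cayley_pos n by (auto simp: defs)
  have m: "m \<noteq> 0" using perp_feet_distinct[OF n(1-3) ne(1,2) ang(1,2)] by (simp add: m_def defs)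
  note p = right_angles_imp_perp[OF n(1-3) ne(1) ang(1,2), folded defs, folded m_def s_def]
  have m': "Re W - Re W' = - m" by (simp add: m_def)
  have p': "(Im V')\<^sup>2 = (Im W')\<^sup>2 + s'\<^sup>2" "s' * (m\<^sup>2 + (Im W)\<^sup>2 - (Im W')\<^sup>2) = - 2 * (Im W')\<^sup>2 * m"
    using right_angles_imp_perp[OF n(4,3,2) ne(3) ang(3,4), folded defs, unfolded m']
    by (simp_all add: s'_def)
  have x: "m + s - s' = Re V' - Re V" by (simp add: m_def s_def s'_def)
  have nested': "m\<^sup>2 + (Im W')\<^sup>2 < (Im W)\<^sup>2" using nested by (simp add: m_def defs)
  note meet = nested_circles_common_perpendicular[OF pos(3,4) m p(1) p'(1) p(3) p'(2) nested', unfolded x]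
  \<comment> \<open>The height at which the vertical line through \<open>v'\<close> meets the circle
    through \<open>v\<close> and \<open>w\<close>.\<close>
  define b where "b = sqrt ((Im V)\<^sup>2 - (Re V' - Re V)\<^sup>2)"
  have "(Im V')\<^sup>2 > 0" using pos by simp
  then have "(Re V' - Re V)\<^sup>2 < (Im V)\<^sup>2" using meet(3) by linarith
  then have b: "b > 0" "b\<^sup>2 = (Im V)\<^sup>2 - (Re V' - Re V)\<^sup>2"
    by (simp_all add: b_def)
  have "(Im V')\<^sup>2 \<le> b\<^sup>2" using meet(3) b(2) by simp
  then have bV': "Im V' \<le> b" using b(1) by (auto intro: power2_le_imp_le)
  obtain z where z: "norm z < 1" "cayley \<xi> z = Complex (Re V') b"
    using cayley_onto[of "Complex (Re V') b"] b(1) by auto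
  have "z \<in> hside v' \<xi>"
    using bV' by (intro mem_hside_ideal[OF n(4) z(1)]) (simp_all add: z(2) V'_def)
  moreover have "z \<in> hside v w"
    using meet b(2) p(1,2) by (intro mem_hside_circle[OF n(1) z(1) n(2)])
      (simp_all add: z(2) defs[symmetric] s_def)
  ultimately show ?thesis by blast
qed

end

section \<open>From half-plane coordinates to the pentagon formulas\<close>

theorem proposition2p2:
  fixes \<xi> :: complex and v w :: "nat \<Rightarrow> complex" and P B S :: "complex set"
    and d :: real and l a :: "nat \<Rightarrow> real"
  assumes "convex_ideal_pentagon \<xi> v w P"
    and "right_angled \<xi> v w"
    and "horoball \<xi> B"
    and "S = horosphere B"
    and "d = hdist (w 0) (w 1)"
    and "\<And>i. i \<in> {0, 1} \<Longrightarrow> l i = hdist (v i) (w i)"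
    and "\<And>i. i \<in> {0, 1} \<Longrightarrow> a i = signed_hdist (v i) B"
  shows "(\<forall>i\<in>{0, 1}. cosh (l i) = (exp (a i) * cosh d + exp (a (1 - i))) / (exp (a i) * sinh d)) \<and>
    sinh (l 0) / exp (a 1) = sinh (l 1) / exp (a 0) \<and>
    (\<forall>\<theta>. arc_of_length_between (S \<inter> P) \<theta> (hside (v 0) \<xi>) (hside (v 1) \<xi>) \<longrightarrow>
         \<theta> / sinh d = sinh (l 0) / exp (a 1) \<and> \<theta> / sinh d = sinh (l 1) / exp (a 0))"
proof -
  have xi: "norm \<xi> = 1" and n: "norm (v 0) < 1" "norm (w 0) < 1" "norm (w 1) < 1" "norm (v 1) < 1"
    and ne: "v 0 \<noteq> w 0" "w 0 \<noteq> w 1" "v 1 \<noteq> w 1"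
    and disj: "hside (v 0) (w 0) \<inter> hside (v 1) \<xi> = {}" "hside (v 1) (w 1) \<inter> hside (v 0) \<xi> = {}"
    using assms(1) unfolding convex_ideal_pentagon_def hplane_def by auto
  \<comment> \<open>The angles at \<open>w 1\<close> and \<open>v 1\<close> are reversed so that
    both ends of the pentagon have the same form.\<close>
  have ang: "hangle \<xi> (v 0) (w 0) = pi / 2" "hangle (v 0) (w 0) (w 1) = pi / 2"
    "hangle \<xi> (v 1) (w 1) = pi / 2" "hangle (v 1) (w 1) (w 0) = pi / 2"
    using assms(2) hangle_commute[of "w 0" "w 1" "v 1"] hangle_commute[of "w 1" "v 1" \<xi>]
    unfolding right_angled_def by simp_all
  define V0 V1 W0 W1 where "V0 = cayley \<xi> (v 0)" and "V1 = cayley \<xi> (v 1)"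
    and "W0 = cayley \<xi> (w 0)" and "W1 = cayley \<xi> (w 1)"
  note defs = V0_def V1_def W0_def W1_def
  define m s0 s1 where "m = Re W1 - Re W0" and "s0 = Re W0 - Re V0" and "s1 = Re W1 - Re V1"
  define y0 y1 q0 q1 where "y0 = Im V0" and "y1 = Im V1" and "q0 = Im W0" and "q1 = Im W1"
  note ydefs = y0_def y1_def q0_def q1_def
  have pos: "q0 > 0" "q1 > 0" "y0 > 0" "y1 > 0"
    using Im_cayley_pos[OF xi] n by (auto simp: defs ydefs)
  have m: "m \<noteq> 0" using perp_feet_distinct[OF xi n(1-3) ne(1,2) ang(1,2)] by (simp add: m_def defs)
  have p0: "y0\<^sup>2 = q0\<^sup>2 + s0\<^sup>2" "s0 * (m\<^sup>2 + q1\<^sup>2 - q0\<^sup>2) = 2 * q0\<^sup>2 * m"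
    using right_angles_imp_perp[OF xi n(1-3) ne(1) ang(1,2), folded defs]
    by (simp_all add: m_def s0_def ydefs)
  have m': "Re W0 - Re W1 = - m" by (simp add: m_def)
  have p1: "y1\<^sup>2 = q1\<^sup>2 + s1\<^sup>2" "s1 * (m\<^sup>2 + q0\<^sup>2 - q1\<^sup>2) = - 2 * q1\<^sup>2 * m"
    using right_angles_imp_perp[OF xi n(4,3,2) ne(3) ang(3,4), folded defs, unfolded m']
    by (simp_all add: s1_def ydefs)
  have good0: "q0\<^sup>2 < m\<^sup>2 + q1\<^sup>2"
  proof (rule ccontr)
    assume "\<not> ?thesis"
    \<comment> \<open>Equality would turn the perpendicularity equation into
      \<open>2 * q0\<^sup>2 * m = 0\<close>.\<close>
    moreover have "m\<^sup>2 + q1\<^sup>2 - q0\<^sup>2 \<noteq> 0"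
    proof
      assume eq: "m\<^sup>2 + q1\<^sup>2 - q0\<^sup>2 = 0"
      show False using p0(2) pos m unfolding eq by simp
    qed
    ultimately have "m\<^sup>2 + q1\<^sup>2 < q0\<^sup>2" by simp
    then show False
      using nested_sides_meet[OF xi n ne ang] disj(1) by (simp add: m_def ydefs defs)
  qed
  have good1: "q1\<^sup>2 < m\<^sup>2 + q0\<^sup>2"
  proof (rule ccontr)
    assume "\<not> ?thesis"
    moreover have "m\<^sup>2 + q0\<^sup>2 - q1\<^sup>2 \<noteq> 0"
    proof
      assume eq: "m\<^sup>2 + q0\<^sup>2 - q1\<^sup>2 = 0"
      show False using p1(2) pos m unfolding eq by simp
    qed
    ultimately have "m\<^sup>2 + q0\<^sup>2 < q1\<^sup>2" by simp
    then show False
      using nested_sides_meet[OF xi n(4,3,2,1) ne(3) ne(2)[symmetric] ne(1) ang(3,4,1,2)] disj(2)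
      by (simp add: m_def ydefs defs power2_commute)
  qed
  define D where "D = (m\<^sup>2 + q0\<^sup>2 + q1\<^sup>2) / (2 * q0 * q1)"
  note good = disjoint_circles_common_perpendicular[OF pos p0(1) p1(1) p0(2) p1(2) good0 good1, folded D_def]
  \<comment> \<open>Exchanging the two ends replaces \<open>m\<close> by \<open>- m\<close>.\<close>
  have "y1 / q1 = (D + y1 / y0) / sqrt (D\<^sup>2 - 1)"
    using disjoint_circles_common_perpendicular(1)[OF pos(2,1,4,3) p1(1) p0(1), of "- m"] p0(2) p1(2) good0 good1
    by (simp add: D_def ac_simps)
  note good = this good
  have cosh_side: "1 + (norm (Y - Q))\<^sup>2 / (2 * Im Y * Im Q) = Im Y / Im Q"
    if "(Im Y)\<^sup>2 = (Im Q)\<^sup>2 + (Re Q - Re Y)\<^sup>2" "Im Y > 0" "Im Q > 0" for Y Q :: complex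
  proof -
    have "(norm (Y - Q))\<^sup>2 = 2 * Im Y * (Im Y - Im Q)"
      unfolding cmod_power2 using that(1) by (simp add: power2_eq_square algebra_simps)
    then show ?thesis using that(2,3) by (simp add: field_simps)
  qed
  have l: "l 0 = arcosh (y0 / q0)" "l 1 = arcosh (y1 / q1)"
    using assms(6) hdist_cayley[OF xi n(1,2)] hdist_cayley[OF xi n(4,3)] pos p0(1) p1(1)
      cosh_side[of V0 W0] cosh_side[of V1 W1]
    by (simp_all add: ydefs s0_def s1_def defs)
  \<comment> \<open>These bounds, like \<open>D \<ge> 1\<close> below, allow \<open>cosh\<close> and
    \<open>sinh\<close> to be evaluated at \<open>arcosh\<close>.\<close>
  have ge1: "y0 / q0 \<ge> 1" "y1 / q1 \<ge> 1"
    using pos p0(1) p1(1) by (auto intro: power2_le_imp_le)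
  have "1 + (norm (W0 - W1))\<^sup>2 / (2 * Im W0 * Im W1) = D"
    using pos unfolding cmod_power2 D_def m_def ydefs
    by (simp add: field_simps power2_eq_square)
  then have d: "d = arcosh D"
    using assms(5) hdist_cayley[OF xi n(2,3)] by (simp add: defs)
  have D: "D \<ge> 1"
  proof -
    have "0 \<le> m\<^sup>2 + (q0 - q1)\<^sup>2" by simp
    then have "2 * q0 * q1 \<le> m\<^sup>2 + q0\<^sup>2 + q1\<^sup>2" by (simp add: power2_diff)
    then show ?thesis using pos by (simp add: D_def)
  qed
  obtain h where h: "h > 0" "horosphere B = {z. norm z < 1 \<and> Im (cayley \<xi> z) = h}"
    "\<And>z. norm z < 1 \<Longrightarrow> z \<in> interior B \<longleftrightarrow> Im (cayley \<xi> z) > h"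
    using horoball_cayley[OF xi assms(3)] by blast
  have a: "exp (a 0) = h / y0" "exp (a 1) = h / y1"
    using assms(7) signed_hdist_cayley[OF xi n(1) h] signed_hdist_cayley[OF xi n(4) h] h(1) pos
    by (simp_all add: ydefs defs)
  have c: "cosh (l 0) = y0 / q0" "cosh (l 1) = y1 / q1" "cosh d = D"
    unfolding l d using ge1 D by simp_all
  have sh: "sinh (l 0) = sqrt ((y0 / q0)\<^sup>2 - 1)" "sinh (l 1) = sqrt ((y1 / q1)\<^sup>2 - 1)"
    "sinh d = sqrt (D\<^sup>2 - 1)"
    unfolding l d using ge1 D by (simp_all only: sinh_arcosh_real)
  have sd: "sinh d > 0" using good(5) by (simp only: sh)
  \<comment> \<open>The choice of horoball enters only through \<open>h\<close>, which cancels
    here.\<close>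
  have frac: "(h / y * D + h / y') / (h / y * sinh d) = (D + y / y') / sinh d"
    if "y > 0" "y' > 0" for y y'
    using that h(1) sd by (simp add: field_simps)
  have "cosh (l 0) = (exp (a 0) * cosh d + exp (a 1)) / (exp (a 0) * sinh d)"
    "cosh (l 1) = (exp (a 1) * cosh d + exp (a 0)) / (exp (a 1) * sinh d)"
    unfolding a c(3) frac[OF pos(3,4)] frac[OF pos(4,3)]
    using good(1,2) by (simp_all only: c sh)
  moreover have "sinh (l 0) / exp (a 1) = sinh (l 1) / exp (a 0)"
    unfolding a sh using good(3) by (simp add: mult.commute)
  moreover have "\<theta> / sinh d = sinh (l 0) / exp (a 1)"
    if \<theta>: "arc_of_length_between (S \<inter> P) \<theta> (hside (v 0) \<xi>) (hside (v 1) \<xi>)" for \<theta>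
  proof -
    obtain g where g: "valid_path g" "arc g" "path_image g = S \<inter> P"
      "pathstart g \<in> hside (v 0) \<xi>" "pathfinish g \<in> hside (v 1) \<xi>" "\<theta> = hlength g"
      using \<theta> unfolding arc_of_length_between_def by blast
    \<comment> \<open>The arc runs along the line at height \<open>h\<close>, and its endpoints lie
      on the vertical rays over \<open>Re V0\<close> and \<open>Re V1\<close>.\<close>
    have "path_image g \<subseteq> {z. norm z < 1 \<and> Im (cayley \<xi> z) = h}"
      using g(3) h(2) assms(4) by auto
    from hlength_horocycle[OF xi g(1,2) h(1) this]
    have "\<theta> = \<bar>Re V1 - Re V0\<bar> / h"
      unfolding g(6) defs hside_ideal_Re[OF xi n(1) g(4)] hside_ideal_Re[OF xi n(4) g(5)] .
    also have "Re V1 - Re V0 = m + s0 - s1" by (simp add: m_def s0_def s1_def)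
    finally have "\<theta> = y1 * sinh (l 0) * sinh d / h" using good(4) by (simp only: sh)
    then show ?thesis unfolding a using sd by (simp add: mult.commute)
  qed
  ultimately show ?thesis by simp
qed

end
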